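(* Let $f\in C^3(\mathbb{R}^d)$, $d\ge 2$, let $k\in\{0,\dots,d\}$, and let $\mathbf{x}^*$ be a strict index-$k$ critical point of $f$. Suppose there are $r_0>0$, $M>0$, $L\ge\mu>0$ such that, with $U=\{\mathbf{x}\in\mathbb{R}^d:\|\mathbf{x}-\mathbf{x}^*\|_2\le r_0\}$, one has $\|\nabla^2 f(\mathbf{x})-\nabla^2 f(\mathbf{y})\|_2\le M\|\mathbf{x}-\mathbf{y}\|_2$ for all $\mathbf{x},\mathbf{y}\in U$, and for every $\mathbf{x}\in U$ the eigenvalues $\lambda_1\le\cdots\le\lambda_d$ of $\nabla^2 f(\mathbf{x})$ satisfy $$-L\le\lambda_1\le\cdots\le\lambda_k\le-\mu<0<\mu\le\lambda_{k+1}\le\cdots\le\lambda_d\le L$$ (the inequalities on the negative, respectively positive, eigenvalues being omitted when $k=0$, respectively $k=d$). Let $(\mathbf{x}_j)_{j\in\mathbb{N}}$ be generated from $\mathbf{x}_0$ by the index-$k$ cubic regularization method (see context) with parameters satisfying $0<\sigma_{\min}\le\sigma_j\le\sigma_{\max}$ for all $j\in\mathbb{N}$. Define $$C=\frac{2L^2\left(\sigma_{\max}+\frac M2\right)}{\mu^3}$$ and let $r>0$ satisfy $$r\le\min\left\{\frac{\mu r_0}{\mu+L},\ \frac{\mu^2}{M(\mu+L)},\ \frac1C\right\}.$$ If $\|\mathbf{x}_0-\mathbf{x}^*\|_2\le r$, then $\mathbf{x}_j\in U$ for all $j\in\mathbb{N}$ and $$\|\mathbf{x}_{j+1}-\mathbf{x}^*\|_2\le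 C\|\mathbf{x}_j-\mathbf{x}^*\|_2^2\qquad\text{for all }j\in\mathbb{N}.$$
   Context: Standing assumption of the paper: $f\in C^3(\mathbb{R}^d)$ with $d\ge2$, having finitely many non-degenerate critical points. $\|\cdot\|_2$ is the Euclidean norm on vectors and the spectral (operator) norm on matrices; $\mathbf{I}$ is the identity matrix; $\mathrm{sym}(A)=\frac12(A+A^\top)$. A strict index-$k$ critical point is a point $\mathbf{x}^*$ with $\nabla f(\mathbf{x}^* )=\mathbf{0}$ such that $\nabla^2 f(\mathbf{x}^* )$ is nonsingular and has exactly $k$ negative eigenvalues (counted with multiplicity). Index-$k$ cubic regularization method: given $\mathbf{x}_0\in\mathbb{R}^d$, for $j=0,1,2,\dots$ (run without an iteration limit): (1) let $\mathbf{v}_1,\dots,\mathbf{v}_k$ be orthonormal eigenvectors of $\nabla^2 f(\mathbf{x}_j)$ associated with its $k$ smallest eigenvalues (counted with multiplicity); (2) set $\mathbf{r}_j=\left(\mathbf{I}-\sum_{i=1}^k2\mathbf{v}_i\mathbf{v}_i^\top\right)\nabla f(\mathbf{x}_j)$ and $B_j=\mathrm{sym}\left(\left(\mathbf{I}-\sum_{i=1}^k2\mathbf{v}_i\mathbf{v}_i^\top\right)\nabla^2 f(\mathbf{x}_j)\right)$; (3) choose a global minimizer $\mathbf{s}_j\in\arg\min_{\mathbf{s}\in\mathbb{R}^d}\ f(\mathbf{x}_j)+\mathbf{r}_j^\top\mathbf{s}+\frac12\mathbf{s}^\top B_j\mathbf{s}+\frac{\sigma_j}{3}\|\mathbf{s}\|_2^3$,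 where $\sigma_j>0$ is the regularization parameter; (4) set $\mathbf{x}_{j+1}=\mathbf{x}_j+\mathbf{s}_j$. Eigenvectors and subproblem minimizers are exact. *)

theory Defs
  imports "HOL-Analysis.Analysis" "HOL-Computational_Algebra.Computational_Algebra"
begin

definition partial_deriv :: "'n::finite \<Rightarrow> (real ^ 'n \<Rightarrow> real) \<Rightarrow> real ^ 'n \<Rightarrow> real" where
  "partial_deriv i f x = frechet_derivative f (at x) (axis i 1)"

primrec C_k :: "nat \<Rightarrow> (real ^ 'n::finite \<Rightarrow> real) \<Rightarrow> bool" where
  "C_k 0 f \<longleftrightarrow> continuous_on UNIV f"
| "C_k (Suc m) f \<longleftrightarrow> (\<forall>x. f differentiable at x) \<and> (\<forall>i. C_k m (partial_deriv i f))"

definition grad :: "(real ^ 'n::finite \<Rightarrow> real) \<Rightarrow> real ^ 'n \<Rightarrow> real ^ 'n" where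
  "grad f x = (\<chi> i. partial_deriv i f x)"

definition hessian :: "(real ^ 'n::finite \<Rightarrow> real) \<Rightarrow> real ^ 'n \<Rightarrow> real ^ 'n ^ 'n" where
  "hessian f x = (\<chi> i j. partial_deriv j (partial_deriv i f) x)"

text \<open>The library norm on \<^typ>\<open>real ^ 'n ^ 'n\<close> is the Frobenius norm, so the
  spectral norm is written as the operator norm of the induced linear map.\<close>

definition spectral_norm :: "real ^ 'n::finite ^ 'n \<Rightarrow> real" where
  "spectral_norm A = onorm (\<lambda>v. A *v v)"

definition sym_part :: "real ^ 'n::finite ^ 'n \<Rightarrow> real ^ 'n ^ 'n" where
  "sym_part A = (1 / 2) *\<^sub>R (A + transpose A)"

definition charpoly :: "real ^ 'n::finite ^ 'n \<Rightarrow> real poly" where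
  "charpoly A = det (mat [:0, 1:] - map_matrix (\<lambda>a. [:a:]) A)"

text \<open>Real eigenvalues with algebraic multiplicity. For symmetric matrices, the only ones
  these notions are applied to, this multiset has \<^term>\<open>CARD('n)\<close> elements, so that
  \<open>eigval A i\<close> is the eigenvalue \<open>\<lambda>\<^sub>i\<close> (numbered from 1, in ascending order) for
  every \<open>i\<close> between 1 and the dimension.\<close>

definition eigenvalues :: "real ^ 'n::finite ^ 'n \<Rightarrow> real multiset" where
  "eigenvalues A = proots (charpoly A)"

definition eigval :: "real ^ 'n::finite ^ 'n \<Rightarrow> nat \<Rightarrow> real" where
  "eigval A i = sorted_list_of_multiset (eigenvalues A) ! (i - 1)"

definition nondegenerate_critical_point :: "(real ^ 'n::finite \<Rightarrow> real) \<Rightarrow> real ^ 'n \<Rightarrow> bool" where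
  "nondegenerate_critical_point f x \<longleftrightarrow> grad f x = 0 \<and> invertible (hessian f x)"

definition strict_index_critical_point ::
    "nat \<Rightarrow> (real ^ 'n::finite \<Rightarrow> real) \<Rightarrow> real ^ 'n \<Rightarrow> bool" where
  "strict_index_critical_point k f x \<longleftrightarrow>
     nondegenerate_critical_point f x \<and> size {# l \<in># eigenvalues (hessian f x). l < 0 #} = k"

text \<open>Orthonormal eigenvectors \<open>v 1, \<dots>, v k\<close> for the \<open>k\<close> smallest eigenvalues.\<close>

definition lowest_eigenvectors ::
    "nat \<Rightarrow> real ^ 'n::finite ^ 'n \<Rightarrow> (nat \<Rightarrow> real ^ 'n) \<Rightarrow> bool" where
  "lowest_eigenvectors k A v \<longleftrightarrow>
     (\<forall>i\<in>{1..k}. A *v v i = eigval A i *\<^sub>R v i) \<and>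
     (\<forall>i\<in>{1..k}. \<forall>j\<in>{1..k}. v i \<bullet> v j = (if i = j then 1 else 0))"

definition outer_product :: "real ^ 'n::finite \<Rightarrow> real ^ 'n \<Rightarrow> real ^ 'n ^ 'n" where
  "outer_product u w = (\<chi> i j. u $ i * w $ j)"

definition reflection :: "nat \<Rightarrow> (nat \<Rightarrow> real ^ 'n::finite) \<Rightarrow> real ^ 'n ^ 'n" where
  "reflection k v = mat 1 - (\<Sum>i = 1..k. 2 *\<^sub>R outer_product (v i) (v i))"

definition cubic_model ::
    "real \<Rightarrow> real ^ 'n::finite \<Rightarrow> real ^ 'n ^ 'n \<Rightarrow> real \<Rightarrow> real ^ 'n \<Rightarrow> real" where
  "cubic_model c g B \<sigma> s = c + g \<bullet> s + (1 / 2) * (s \<bullet> (B *v s)) + (\<sigma> / 3) * norm s ^ 3"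

text \<open>The step is a relation, since neither the eigenvectors nor the global minimizer need be
  unique.\<close>

definition cubic_reg_step ::
    "nat \<Rightarrow> (real ^ 'n::finite \<Rightarrow> real) \<Rightarrow> real \<Rightarrow> real ^ 'n \<Rightarrow> real ^ 'n \<Rightarrow> bool" where
  "cubic_reg_step k f \<sigma> x x' \<longleftrightarrow>
     (\<exists>v g B s.
        lowest_eigenvectors k (hessian f x) v \<and>
        g = reflection k v *v grad f x \<and>
        B = sym_part (reflection k v ** hessian f x) \<and>
        (\<forall>t. cubic_model (f x) g B \<sigma> s \<le> cubic_model (f x) g B \<sigma> t) \<and>
        x' = x + s)"

definition cubic_reg_sequence ::
    "nat \<Rightarrow> (real ^ 'n::finite \<Rightarrow> real) \<Rightarrow> (nat \<Rightarrow> real) \<Rightarrow> (nat \<Rightarrow> real ^ 'n) \<Rightarrow> bool" where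
  "cubic_reg_sequence k f \<sigma> x \<longleftrightarrow> (\<forall>j. cubic_reg_step k f (\<sigma> j) (x j) (x (Suc j)))"

end

theory Submission
  imports Defs
begin

text \<open>Write \<open>H\<close> for the Hessian and \<open>g\<close> for the gradient at the current iterate, \<open>R\<close> for the
  reflection and \<open>e\<close> for the current error. Since \<open>R\<close> is built from eigenvectors of the symmetric
  matrix \<open>H\<close>, it is an orthogonal involution commuting with \<open>H\<close>, so \<open>B = R H\<close> is the absolute value
  of \<open>H\<close>, with spectrum in \<open>[\<mu>, L]\<close>. Stationarity of the cubic model reads
  \<open>R g + R H s + \<sigma> \<parallel>s\<parallel> s = 0\<close>. Pairing with \<open>s\<close> gives \<open>\<mu> \<parallel>s\<parallel> \<le> \<parallel>g\<parallel> \<le> L \<parallel>e\<parallel>\<close>; applying \<open>R\<close> gives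
  \<open>H (e + s) = (H e - g) - \<sigma> \<parallel>s\<parallel> R s\<close>, where \<open>\<parallel>H e - g\<parallel> \<le> M \<parallel>e\<parallel>\<^sup>2\<close> by the mean value inequality.
  Since \<open>\<parallel>H w\<parallel> \<ge> \<mu> \<parallel>w\<parallel>\<close>, the new error \<open>e + s\<close> satisfies
  \<open>\<mu> \<parallel>e + s\<parallel> \<le> (M + \<sigma> L\<^sup>2 / \<mu>\<^sup>2) \<parallel>e\<parallel>\<^sup>2 \<le> \<mu> C \<parallel>e\<parallel>\<^sup>2\<close>.\<close>

subsection \<open>Spectral theorem for symmetric matrices\<close>

lemma symmetric_inner_matrix:
  fixes A :: "real ^ 'n::finite ^ 'n"
  assumes "transpose A = A"
  shows "x \<bullet> (A *v y) = (A *v x) \<bullet> y"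
proof -
  have "x v* A = A *v x" by (metis assms vector_transpose_matrix)
  then show ?thesis by (metis dot_lmul_matrix)
qed

text \<open>First-order optimality without derivatives: a first-order gain always dominated by a
  second-order cost must vanish. It serves both the Rayleigh quotient and the cubic model.\<close>

lemma linear_le_quadratic_imp_zero:
  fixes a K :: real
  assumes "a \<ge> 0" and le: "\<And>t. 0 < t \<Longrightarrow> t \<le> 1 \<Longrightarrow> t * a \<le> t\<^sup>2 * K"
  shows "a = 0"
proof (rule ccontr)
  assume "a \<noteq> 0"
  then have a: "a > 0" using assms by simp
  have K: "a \<le> K" using le[of 1] by simp
  \<comment> \<open>The case \<open>t = 1\<close> gives \<open>K \<ge> a > 0\<close>, so
    \<open>t = a / (2 * K)\<close> is at most 1/2 and admissible; it turns the bound into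
    \<open>a \<le> a / 2\<close>.\<close>
  have "a / (2 * K) * a \<le> (a / (2 * K))\<^sup>2 * K"
    using a K by (intro le) auto
  then have "2 * a * a \<le> a * a"
    using a K by (simp add: field_simps power2_eq_square)
  then show False using a by simp
qed

text \<open>The eigenvalue of a unit eigenvector is written as its Rayleigh quotient, so a bare set
  of vectors carries the spectral data.\<close>

definition orthonormal_eigenvectors :: "real ^ 'n::finite ^ 'n \<Rightarrow> (real ^ 'n) set \<Rightarrow> bool" where
  "orthonormal_eigenvectors A S \<longleftrightarrow>
     pairwise orthogonal S \<and> (\<forall>u\<in>S. norm u = 1 \<and> A *v u = (u \<bullet> (A *v u)) *\<^sub>R u)"

text \<open>The maximizer of the Rayleigh quotient on the unit sphere of the subspace is an eigenvector:
  its first variation in the direction of the residual vanishes.\<close>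

lemma symmetric_eigenvector_in_subspace:
  fixes A :: "real ^ 'n::finite ^ 'n"
  assumes sym: "transpose A = A" and V: "subspace V" and inv: "\<And>v. v \<in> V \<Longrightarrow> A *v v \<in> V"
    and w: "w \<in> V" "w \<noteq> 0"
  obtains u where "u \<in> V" "norm u = 1" "A *v u = (u \<bullet> (A *v u)) *\<^sub>R u"
proof -
  let ?K = "V \<inter> sphere 0 1" and ?q = "\<lambda>v. v \<bullet> (A *v v)"
  have "compact ?K" using V by (simp add: closed_subspace closed_Int_compact)
  moreover have "w /\<^sub>R norm w \<in> ?K" using w V by (simp add: subspace_scale)
  moreover have "continuous_on ?K ?q"
    by (intro continuous_intros linear_continuous_on matrix_vector_mul_bounded_linear)
  ultimately obtain u where u: "u \<in> ?K" and max: "\<And>v. v \<in> ?K \<Longrightarrow> ?q v \<le> ?q u"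
    using continuous_attains_sup[of ?K ?q] by blast
  define l where "l = ?q u"
  \<comment> \<open>Homogeneity extends maximality from the unit sphere to all of \<open>V\<close>,
    so the perturbation of \<open>u\<close> can be tested without normalizing it.\<close>
  have le: "?q v \<le> l * (v \<bullet> v)" if v: "v \<in> V" for v
  proof (cases "v = 0")
    case False
    have "v /\<^sub>R norm v \<in> ?K" using v False V by (simp add: subspace_scale)
    then have "?q (v /\<^sub>R norm v) \<le> l" unfolding l_def by (rule max)
    then have "?q v / (norm v)\<^sup>2 \<le> l"
      by (simp add: matrix_vector_mult_scaleR power2_eq_square field_simps)
    then show ?thesis using False
      by (simp add: pos_divide_le_eq power2_norm_eq_inner)
  qed simp
  define p where "p = A *v u - l *\<^sub>R u"
  have pV: "p \<in> V" using u V inv by (simp add: p_def subspace_diff subspace_scale)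
  have uu: "u \<bullet> u = 1" using u by (simp add: norm_eq_1)
  have "p \<bullet> p = 0"
  proof (rule linear_le_quadratic_imp_zero)
    fix t :: real
    assume t: "0 < t" "t \<le> 1"
    have "u + t *\<^sub>R p \<in> V" using u pV V by (simp add: subspace_add subspace_scale)
    then have 1: "?q (u + t *\<^sub>R p) \<le> l * ((u + t *\<^sub>R p) \<bullet> (u + t *\<^sub>R p))" by (rule le)
    have "u \<bullet> (A *v p) = p \<bullet> (A *v u)" by (simp add: symmetric_inner_matrix[OF sym, of u p] inner_commute)
    then have 2: "?q (u + t *\<^sub>R p) = l + 2 * t * (p \<bullet> (A *v u)) + t\<^sup>2 * ?q p"
      by (simp add: l_def matrix_vector_right_distrib matrix_vector_mult_scaleR inner_add_left
          inner_add_right power2_eq_square algebra_simps)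
    have 3: "(u + t *\<^sub>R p) \<bullet> (u + t *\<^sub>R p) = 1 + 2 * t * (p \<bullet> u) + t\<^sup>2 * (p \<bullet> p)"
      using uu by (simp add: inner_add_left inner_add_right power2_eq_square algebra_simps
          inner_commute)
    have 4: "p \<bullet> (A *v u) - l * (p \<bullet> u) = p \<bullet> p"
      by (simp add: p_def inner_diff_right)
    \<comment> \<open>The constant term \<open>l\<close> cancels on both sides of 1; what remains is
      linear against quadratic in \<open>t\<close>, with linear coefficient
      \<open>2 * (p \<bullet> p)\<close> by 4.\<close>
    have "2 * (t * (p \<bullet> (A *v u) - l * (p \<bullet> u))) \<le> t\<^sup>2 * (l * (p \<bullet> p) - ?q p)"
      using 1 unfolding 2 3 by (simp add: algebra_simps)
    then show "t * (p \<bullet> p) \<le> t\<^sup>2 * ((l * (p \<bullet> p) - ?q p) / 2)"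
      unfolding 4 by simp
  qed simp
  then show thesis using u by (intro that[of u]) (simp_all add: p_def l_def)
qed

lemma orthonormal_eigenvectors_card_le:
  fixes A :: "real ^ 'n::finite ^ 'n"
  assumes "orthonormal_eigenvectors A S"
  shows "finite S" "independent S" "card S \<le> CARD('n)"
proof -
  show "independent S"
    using assms by (intro pairwise_orthogonal_independent) (auto simp: orthonormal_eigenvectors_def)
  then show "finite S" "card S \<le> CARD('n)" using independent_bound[of S] by auto
qed

text \<open>The orthogonal complement of a set of eigenvectors is invariant under a symmetric
  matrix, so it contains a further eigenvector as long as it is nonzero. Starting from an arbitrary
  \<open>S\<close> keeps the eigenvectors chosen by the method in the basis.\<close>

lemma orthonormal_eigenvectors_extend:
  fixes A :: "real ^ 'n::finite ^ 'n"
  assumes sym: "transpose A = A" and S: "orthonormal_eigenvectors A S"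
  obtains T where "S \<subseteq> T" "orthonormal_eigenvectors A T" "card T = CARD('n)"
  using S
proof (induction "CARD('n) - card S" arbitrary: S thesis rule: less_induct)
  case less
  note S = \<open>orthonormal_eigenvectors A S\<close>
  note fin = orthonormal_eigenvectors_card_le[OF S]
  show ?case
  proof (cases "card S = CARD('n)")
    case True
    then show ?thesis using less.prems by blast
  next
    case False
    let ?V = "{w. \<forall>u\<in>S. u \<bullet> w = 0}"
    have "dim S < DIM(real ^ 'n)" using fin False by (simp add: dim_eq_card_independent)
    then obtain w where w: "w \<noteq> 0" "\<And>y. y \<in> span S \<Longrightarrow> orthogonal w y"
      using orthogonal_to_subspace_exists by blast
    have wV: "w \<in> ?V" using w(2) by (auto simp: orthogonal_def inner_commute span_base)
    have V: "subspace ?V" by (auto simp: subspace_def inner_add_right)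
    have inv: "A *v v \<in> ?V" if v: "v \<in> ?V" for v
    proof -
      have "u \<bullet> (A *v v) = 0" if u: "u \<in> S" for u
      proof -
        have "A *v u = (u \<bullet> (A *v u)) *\<^sub>R u"
          using S u by (simp add: orthonormal_eigenvectors_def)
        then have "u \<bullet> (A *v v) = (u \<bullet> (A *v u)) * (u \<bullet> v)"
          by (metis symmetric_inner_matrix[OF sym] inner_scaleR_left)
        then show ?thesis using v u by simp
      qed
      then show ?thesis by blast
    qed
    obtain u where u: "u \<in> ?V" "norm u = 1" "A *v u = (u \<bullet> (A *v u)) *\<^sub>R u"
      using symmetric_eigenvector_in_subspace[OF sym V inv wV w(1)] by blast
    have "u \<notin> S" using u by (auto simp: norm_eq_1)
    have S': "orthonormal_eigenvectors A (insert u S)"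
      using S u unfolding orthonormal_eigenvectors_def
      by (auto simp: pairwise_insert orthogonal_def inner_commute)
    have "CARD('n) - card (insert u S) < CARD('n) - card S"
      using fin False \<open>u \<notin> S\<close> by simp
    then obtain T where "insert u S \<subseteq> T" "orthonormal_eigenvectors A T" "card T = CARD('n)"
      using less.hyps S' by blast
    then show ?thesis using less.prems by blast
  qed
qed

lemma eigenvector_basis_expand:
  fixes A :: "real ^ 'n::finite ^ 'n"
  assumes T: "orthonormal_eigenvectors A T" "card T = CARD('n)"
  shows "(\<Sum>u\<in>T. (u \<bullet> w) *\<^sub>R u) = w"
proof -
  note fin = orthonormal_eigenvectors_card_le[OF T(1)]
  have "span T = UNIV"
    using fin T(2) by (metis DIM_cart DIM_real dim_eq_card_independent dim_eq_full mult.right_neutral)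
  then show ?thesis
    using orthonormal_basis_expand[of T w] T fin
    by (simp add: orthonormal_eigenvectors_def inner_commute)
qed

lemma eigenvector_basis_inner:
  fixes A :: "real ^ 'n::finite ^ 'n"
  assumes T: "orthonormal_eigenvectors A T" "card T = CARD('n)"
  shows "x \<bullet> y = (\<Sum>u\<in>T. (u \<bullet> x) * (u \<bullet> y))"
proof -
  have "x \<bullet> y = x \<bullet> (\<Sum>u\<in>T. (u \<bullet> y) *\<^sub>R u)"
    using eigenvector_basis_expand[OF T] by simp
  then show ?thesis by (simp add: inner_sum_right inner_commute mult.commute)
qed

section \<open>Characteristic polynomial and sorted spectrum from an eigenbasis\<close>

lemma matrix_matrix_mult_diff_ldistrib:
  fixes A :: "'a::ring_1 ^ 'n::finite ^ 'm"
  shows "A ** (B - C) = A ** B - A ** C"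
  by (simp add: vec_eq_iff matrix_matrix_mult_def sum_subtractf right_diff_distrib)

lemma matrix_matrix_mult_diff_rdistrib:
  fixes A :: "'a::ring_1 ^ 'n::finite ^ 'm"
  shows "(A - B) ** C = A ** C - B ** C"
  by (simp add: vec_eq_iff matrix_matrix_mult_def sum_subtractf left_diff_distrib)

lemma map_matrix_pCons_mult:
  fixes A B :: "real ^ 'n::finite ^ 'n"
  shows "map_matrix (\<lambda>a. [:a:]) (A ** B) = map_matrix (\<lambda>a. [:a:]) A ** map_matrix (\<lambda>a. [:a:]) B"
  by (simp add: vec_eq_iff matrix_matrix_mult_def sum_to_poly)
    (simp add: mult.commute)

text \<open>With the basis vectors as columns of \<open>P\<close>, \<open>A ** P = P ** D\<close>
  for a diagonal \<open>D\<close>. The scalar matrix of the indeterminate commutes with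
  \<open>P\<close>, so the same relation holds between the two characteristic matrices, and
  determinants can be compared.\<close>

lemma charpoly_eigenvector_basis:
  fixes A :: "real ^ 'n::finite ^ 'n"
  assumes T: "orthonormal_eigenvectors A T" "card T = CARD('n)"
  shows "charpoly A = (\<Prod>u\<in>T. [:- (u \<bullet> (A *v u)), 1:])"
proof -
  note fin = orthonormal_eigenvectors_card_le[OF T(1)]
  obtain b :: "'n \<Rightarrow> real ^ 'n" where b: "bij_betw b UNIV T"
    using finite_same_card_bij[of "UNIV :: 'n set" T] fin T(2) by auto
  define q where "q = (\<lambda>u. u \<bullet> (A *v u))"
  define P :: "real ^ 'n ^ 'n" where "P = (\<chi> i j. b j $ i)"
  define D :: "real ^ 'n ^ 'n" where "D = (\<chi> i j. if i = j then q (b i) else 0)"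
  let ?c = "map_matrix (\<lambda>a::real. [:a:]) :: real ^ 'n ^ 'n \<Rightarrow> real poly ^ 'n ^ 'n"
  let ?X = "mat [:0, 1:] :: real poly ^ 'n ^ 'n"
  have bT: "b j \<in> T" for j using b by (auto simp: bij_betw_def)
  have binj: "b i = b j \<longleftrightarrow> i = j" for i j using b by (auto simp: bij_betw_def inj_on_def)
  have "transpose P ** P = mat 1"
  proof -
    have "b i \<bullet> b j = (if i = j then 1 else 0)" for i j
    proof (cases "i = j")
      case True
      then show ?thesis using T(1) bT[of i] by (simp add: orthonormal_eigenvectors_def norm_eq_1)
    next
      case False
      then show ?thesis using T(1) bT[of i] bT[of j] binj[of i j]
        by (auto simp: orthonormal_eigenvectors_def pairwise_def orthogonal_def)
    qed
    then show ?thesis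
      by (simp add: vec_eq_iff matrix_matrix_mult_def transpose_def P_def mat_def inner_vec_def)
  qed
  then have "det P * det P = 1" by (metis det_I det_mul det_transpose)
  then have P1: "?c (transpose P) ** ?c P = mat 1"
    using \<open>transpose P ** P = mat 1\<close>
    by (simp add: vec_eq_iff mat_def flip: map_matrix_pCons_mult)
  \<comment> \<open>Polynomials form an integral domain, so this determinant can be cancelled once
    it is nonzero.\<close>
  then have dP: "det (?c P) \<noteq> 0" by (metis det_I det_mul mult_zero_right zero_neq_one)
  have AP: "A ** P = P ** D"
  proof -
    have "(A *v b j) $ i = q (b j) * b j $ i" for i j
      using T(1) bT[of j] by (simp add: orthonormal_eigenvectors_def q_def vec_eq_iff)
    then show ?thesis
      by (simp add: vec_eq_iff matrix_matrix_mult_def matrix_vector_mult_def P_def D_def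
          if_distrib mult.commute cong: if_cong)
  qed
  have X: "?X ** ?c P = ?c P ** ?X"
    by (simp add: vec_eq_iff matrix_matrix_mult_def mat_def if_distrib if_distribR
        mult.commute cong: if_cong)
  have "(?X - ?c A) ** ?c P = ?X ** ?c P - ?c (A ** P)"
    by (simp add: map_matrix_pCons_mult matrix_matrix_mult_diff_rdistrib)
  also have "\<dots> = ?c P ** (?X - ?c D)"
    by (simp add: AP X map_matrix_pCons_mult matrix_matrix_mult_diff_ldistrib)
  finally have "det (?X - ?c A) * det (?c P) = det (?c P) * det (?X - ?c D)"
    by (metis det_mul)
  then have "charpoly A = det (?X - ?c D)" using dP by (simp add: charpoly_def)
  also have "\<dots> = (\<Prod>i\<in>UNIV. [:- q (b i), 1:])"
    by (subst det_diagonal) (auto simp: mat_def D_def)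
  also have "\<dots> = (\<Prod>u\<in>T. [:- q u, 1:])"
    using prod.reindex_bij_betw[OF b, of "\<lambda>u. [:- q u, 1:]"] by simp
  finally show ?thesis by (simp add: q_def)
qed

text \<open>Each linear factor contributes one root, so algebraic multiplicity becomes a count of
  basis vectors.\<close>

lemma eigenvalues_eigenvector_basis:
  fixes A :: "real ^ 'n::finite ^ 'n"
  assumes T: "orthonormal_eigenvectors A T" "card T = CARD('n)"
  shows "eigenvalues A = image_mset (\<lambda>u. u \<bullet> (A *v u)) (mset_set T)"
proof -
  have "eigenvalues A = (\<Sum>u\<in>T. {#u \<bullet> (A *v u)#})"
    unfolding eigenvalues_def charpoly_eigenvector_basis[OF T]
    by (subst proots_prod) auto
  also have "\<dots> = image_mset (\<lambda>u. u \<bullet> (A *v u)) (mset_set T)"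
    by (simp add: sum_unfold_sum_mset)
  finally show ?thesis .
qed

lemma orthonormal_eigenvectors_lowest:
  assumes "lowest_eigenvectors k A v"
  shows "orthonormal_eigenvectors A (v ` {1..k})" "inj_on v {1..k}"
proof -
  have on: "v i \<bullet> v j = (if i = j then 1 else 0)" if "i \<in> {1..k}" "j \<in> {1..k}" for i j
    using assms that by (simp add: lowest_eigenvectors_def)
  have ev: "A *v v i = eigval A i *\<^sub>R v i" if "i \<in> {1..k}" for i
    using assms that by (simp add: lowest_eigenvectors_def)
  show "inj_on v {1..k}" using on by (metis inj_onI zero_neq_one)
  show "orthonormal_eigenvectors A (v ` {1..k})"
    unfolding orthonormal_eigenvectors_def pairwise_def orthogonal_def norm_eq_1
    using on ev by auto
qed

text \<open>The full eigenbasis represents the spectrum as a multiset; removing the \<open>k\<close> smallest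
  eigenvalues from it leaves exactly those numbered \<open>k + 1, \<dots>, n\<close>, also in the presence
  of repeated eigenvalues.\<close>

lemma lowest_eigenvectors_extend:
  fixes A :: "real ^ 'n::finite ^ 'n"
  assumes sym: "transpose A = A" and low: "lowest_eigenvectors k A v"
  obtains T where "v ` {1..k} \<subseteq> T" "orthonormal_eigenvectors A T" "card T = CARD('n)"
    "\<And>u. u \<in> T - v ` {1..k} \<Longrightarrow> \<exists>i\<in>{k+1..CARD('n)}. u \<bullet> (A *v u) = eigval A i"
proof -
  let ?S = "v ` {1..k}" and ?q = "\<lambda>u. u \<bullet> (A *v u)"
  note S = orthonormal_eigenvectors_lowest[OF low]
  obtain T where T: "?S \<subseteq> T" "orthonormal_eigenvectors A T" "card T = CARD('n)"
    using orthonormal_eigenvectors_extend[OF sym S(1)] by blast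
  have fin: "finite T" by (rule orthonormal_eigenvectors_card_le[OF T(2)])
  have k: "k \<le> CARD('n)"
    using orthonormal_eigenvectors_card_le(3)[OF S(1)] S(2) by (simp add: card_image)
  define l where "l = sorted_list_of_multiset (eigenvalues A)"
  have ml: "mset l = image_mset ?q (mset_set T)"
    by (simp add: l_def eigenvalues_eigenvector_basis[OF T(2,3)])
  then have len: "length l = CARD('n)"
    using T(3) by (metis size_image_mset size_mset size_mset_set)
  \<comment> \<open>\<open>eigval\<close> numbers from 1, list positions start at 0.\<close>
  have qv: "?q (v i) = l ! (i - 1)" if "i \<in> {1..k}" for i
    using low that by (simp add: lowest_eigenvectors_def eigval_def l_def)
  have "image_mset ?q (mset_set ?S) = image_mset ?q (image_mset v (mset_set {1..k}))"
    by (simp only: image_mset_mset_set[OF S(2)])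
  also have "\<dots> = image_mset (\<lambda>i. ?q (v i)) (mset_set {1..k})"
    by (simp only: image_mset.compositionality o_def)
  also have "\<dots> = image_mset (\<lambda>i. l ! (i - 1)) (mset_set {1..k})"
    using qv by (intro image_mset_cong) simp
  also have "\<dots> = image_mset (\<lambda>i. l ! i) (mset_set {0..<k})"
  proof -
    have "mset_set {1..k} = image_mset Suc (mset_set {0..<k})"
      by (simp add: image_mset_mset_set image_Suc_atLeastLessThan atLeastLessThanSuc_atLeastAtMost)
    then show ?thesis by (simp add: image_mset.compositionality o_def)
  qed
  also have "\<dots> = mset (take k l)"
  proof -
    have "take k l = map ((!) l) [0..<k]" using k len by (intro nth_equalityI) simp_all
    then show ?thesis by (simp flip: mset_upt)
  qed
  finally have mS: "image_mset ?q (mset_set ?S) = mset (take k l)" .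
  have "mset_set T = mset_set ?S + mset_set (T - ?S)"
    using mset_set_Union[of ?S "T - ?S"] fin T(1) by (simp add: Un_absorb1)
  \<comment> \<open>Both sides are the full spectrum and share the part of the \<open>k\<close>
    smallest eigenvalues. Cancelling as multisets stays correct when an eigenvalue occurs on both
    sides of the cut.\<close>
  then have "mset (take k l) + mset (drop k l) = mset (take k l) + image_mset ?q (mset_set (T - ?S))"
    using ml mS by (simp flip: mset_append)
  then have "mset (drop k l) = image_mset ?q (mset_set (T - ?S))" by simp
  then have set: "set (drop k l) = ?q ` (T - ?S)"
    using fin by (metis finite_Diff finite_set_mset_mset_set set_image_mset set_mset_mset)
  have "\<exists>i\<in>{k+1..CARD('n)}. ?q u = eigval A i" if u: "u \<in> T - ?S" for u
  proof -
    have "?q u \<in> set (drop k l)" using u set by blast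
    then obtain j where j: "j < length l - k" "?q u = drop k l ! j"
      by (metis in_set_conv_nth length_drop)
    \<comment> \<open>Position \<open>j\<close> in \<open>drop k l\<close> is position
      \<open>k + j\<close> in \<open>l\<close>, hence eigenvalue number
      \<open>k + j + 1\<close>.\<close>
    then have "?q u = eigval A (k + j + 1)" using k len by (simp add: eigval_def l_def)
    then show ?thesis using j len by (intro bexI[of _ "k + j + 1"]) auto
  qed
  then show thesis using that T by blast
qed

text \<open>In an eigenbasis \<open>A\<close> scales each coordinate by an eigenvalue of modulus at
  most \<open>L\<close>; Parseval gives the norm bound.\<close>

lemma symmetric_norm_le:
  fixes A :: "real ^ 'n::finite ^ 'n"
  assumes sym: "transpose A = A" and L: "\<And>i. i \<in> {1..CARD('n)} \<Longrightarrow> \<bar>eigval A i\<bar> \<le> L"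
  shows "norm (A *v w) \<le> L * norm w"
proof -
  \<comment> \<open>With \<open>k = 0\<close> nothing is prescribed, and the extension yields an
    eigenbasis all of whose Rayleigh quotients are numbered eigenvalues.\<close>
  have "lowest_eigenvectors 0 A (\<lambda>_. 0)" by (simp add: lowest_eigenvectors_def)
  then obtain T where T: "orthonormal_eigenvectors A T" "card T = CARD('n)"
      "\<And>u. u \<in> T \<Longrightarrow> \<exists>i\<in>{1..CARD('n)}. u \<bullet> (A *v u) = eigval A i"
    using lowest_eigenvectors_extend[OF sym, of 0 "\<lambda>_. 0"] by auto
  have L0: "0 \<le> L"
  proof -
    have "1 \<in> {1..CARD('n)}" by (simp add: Suc_leI)
    from L[OF this] show ?thesis by linarith
  qed
  have "(norm (A *v w))\<^sup>2 = (\<Sum>u\<in>T. (u \<bullet> (A *v w)) * (u \<bullet> (A *v w)))"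
    unfolding power2_norm_eq_inner by (rule eigenvector_basis_inner[OF T(1,2)])
  also have "\<dots> \<le> (\<Sum>u\<in>T. L\<^sup>2 * ((u \<bullet> w) * (u \<bullet> w)))"
  proof (rule sum_mono)
    fix u assume u: "u \<in> T"
    have "A *v u = (u \<bullet> (A *v u)) *\<^sub>R u" using T(1) u by (simp add: orthonormal_eigenvectors_def)
    then have "u \<bullet> (A *v w) = (u \<bullet> (A *v u)) * (u \<bullet> w)"
      by (metis symmetric_inner_matrix[OF sym] inner_scaleR_left)
    moreover have "(u \<bullet> (A *v u))\<^sup>2 \<le> L\<^sup>2" using T(3)[OF u] L L0 by (metis abs_le_square_iff abs_of_nonneg)
    ultimately show "(u \<bullet> (A *v w)) * (u \<bullet> (A *v w)) \<le> L\<^sup>2 * ((u \<bullet> w) * (u \<bullet> w))"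
      by (metis mult_right_mono power2_eq_square power_mult_distrib zero_le_power2)
  qed
  also have "\<dots> = (L * norm w)\<^sup>2"
    by (simp add: power_mult_distrib power2_norm_eq_inner eigenvector_basis_inner[OF T(1,2), of w w]
        flip: sum_distrib_left)
  finally show ?thesis by (rule power2_le_imp_le) (use L0 in simp)
qed

subsection \<open>The reflection\<close>

lemma reflection_mult_vec:
  fixes v :: "nat \<Rightarrow> real ^ 'n::finite"
  shows "reflection k v *v w = w - (\<Sum>i = 1..k. (2 * (v i \<bullet> w)) *\<^sub>R v i)"
proof -
  have *: "outer_product u u *v w = (u \<bullet> w) *\<^sub>R u" for u :: "real ^ 'n"
    by (simp add: vec_eq_iff matrix_vector_mult_def outer_product_def inner_vec_def
        sum_distrib_left sum_distrib_right mult_ac)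
  have "(\<Sum>i = 1..k. 2 *\<^sub>R outer_product (v i) (v i)) *v w = (\<Sum>i = 1..k. (2 * (v i \<bullet> w)) *\<^sub>R v i)"
    by (induction k) (simp_all add: matrix_vector_mult_add_rdistrib scaleR_matrix_vector_assoc[symmetric] *)
  then show ?thesis by (simp add: reflection_def matrix_vector_mult_diff_rdistrib)
qed

lemma transpose_reflection: "transpose (reflection k v) = reflection k v"
  by (simp add: reflection_def vec_eq_iff transpose_def mat_def outer_product_def mult.commute
      sum_component)

text \<open>The reflection negates every coefficient along \<open>v j\<close>, so the second
  application adds back what the first subtracts.\<close>

lemma reflection_involution:
  assumes "lowest_eigenvectors k A v"
  shows "reflection k v *v (reflection k v *v w) = w"
proof -
  have "v j \<bullet> (reflection k v *v w) = - (v j \<bullet> w)" if j: "j \<in> {1..k}" for j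
  proof -
    have "v j \<bullet> (\<Sum>i = 1..k. (2 * (v i \<bullet> w)) *\<^sub>R v i) = (\<Sum>i = 1..k. if j = i then 2 * (v i \<bullet> w) else 0)"
      unfolding inner_sum_right using assms j
      by (intro sum.cong) (auto simp: lowest_eigenvectors_def)
    also have "\<dots> = 2 * (v j \<bullet> w)" using j by simp
    finally show ?thesis by (simp add: reflection_mult_vec inner_diff_right)
  qed
  then have "(\<Sum>i = 1..k. (2 * (v i \<bullet> (reflection k v *v w))) *\<^sub>R v i)
      = (\<Sum>i = 1..k. - ((2 * (v i \<bullet> w)) *\<^sub>R v i))"
    by (intro sum.cong) simp_all
  then have "reflection k v *v (reflection k v *v w)
      = reflection k v *v w + (\<Sum>i = 1..k. (2 * (v i \<bullet> w)) *\<^sub>R v i)"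
    by (subst reflection_mult_vec) (simp add: sum_negf)
  then show ?thesis by (simp add: reflection_mult_vec)
qed

lemma norm_reflection:
  assumes "lowest_eigenvectors k A v"
  shows "norm (reflection k v *v w) = norm w"
  by (simp add: norm_eq_sqrt_inner reflection_involution[OF assms]
      symmetric_inner_matrix[OF transpose_reflection, symmetric])

text \<open>Projection onto an eigenvector of a symmetric matrix commutes with that matrix.\<close>

lemma reflection_commute:
  assumes sym: "transpose A = A" and low: "lowest_eigenvectors k A v"
  shows "reflection k v *v (A *v w) = A *v (reflection k v *v w)"
proof -
  have "(v i \<bullet> (A *v w)) *\<^sub>R v i = (v i \<bullet> w) *\<^sub>R (A *v v i)" if "i \<in> {1..k}" for i
    using low that by (simp add: lowest_eigenvectors_def symmetric_inner_matrix[OF sym])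
  then have "(\<Sum>i = 1..k. (2 * (v i \<bullet> (A *v w))) *\<^sub>R v i) = (\<Sum>i = 1..k. (2 * (v i \<bullet> w)) *\<^sub>R (A *v v i))"
    by (intro sum.cong) (simp_all flip: scaleR_scaleR)
  also have "\<dots> = A *v (\<Sum>i = 1..k. (2 * (v i \<bullet> w)) *\<^sub>R v i)"
    by (simp add: linear_sum[OF matrix_vector_mul_linear] matrix_vector_mult_scaleR)
  finally show ?thesis by (simp add: reflection_mult_vec matrix_vector_mult_diff_distrib)
qed

text \<open>Commuting symmetric matrices have a symmetric product; hence the matrix \<open>B\<close>
  of the method is the reflected Hessian itself.\<close>

lemma reflection_symmetric:
  assumes sym: "transpose A = A" and low: "lowest_eigenvectors k A v"
  shows "transpose (reflection k v ** A) = reflection k v ** A"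
    and "sym_part (reflection k v ** A) = reflection k v ** A"
proof -
  have "A ** reflection k v = reflection k v ** A"
    by (simp add: matrix_eq reflection_commute[OF assms] flip: matrix_vector_mul_assoc)
  then show 1: "transpose (reflection k v ** A) = reflection k v ** A"
    by (simp add: matrix_transpose_mul sym transpose_reflection)
  show "sym_part (reflection k v ** A) = reflection k v ** A"
    by (simp add: sym_part_def 1 flip: scaleR_2)
qed

text \<open>In an eigenbasis extending \<open>v\<close>, the reflected matrix is diagonal: the
  \<open>k\<close> lowest eigenvalues change sign and the others stay, so every diagonal entry is at
  least \<open>\<mu>\<close>.\<close>

lemma reflection_positive_definite:
  fixes A :: "real ^ 'n::finite ^ 'n"
  assumes sym: "transpose A = A" and low: "lowest_eigenvectors k A v"
    and neg: "\<And>i. i \<in> {1..k} \<Longrightarrow> eigval A i \<le> - \<mu>"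
    and pos: "\<And>i. i \<in> {k+1..CARD('n)} \<Longrightarrow> \<mu> \<le> eigval A i"
  shows "\<mu> * (norm w)\<^sup>2 \<le> w \<bullet> (reflection k v *v (A *v w))"
proof -
  let ?S = "v ` {1..k}" and ?q = "\<lambda>u. u \<bullet> (A *v u)"
  obtain T where T: "?S \<subseteq> T" "orthonormal_eigenvectors A T" "card T = CARD('n)"
    and rest: "\<And>u. u \<in> T - ?S \<Longrightarrow> \<exists>i\<in>{k+1..CARD('n)}. ?q u = eigval A i"
    using lowest_eigenvectors_extend[OF sym low] by blast
  \<comment> \<open>By symmetry both matrices are moved onto \<open>u\<close>, where the reflection
    acts by a sign and \<open>A\<close> by an eigenvalue.\<close>
  have Rv: "u \<bullet> (reflection k v *v (A *v w)) = (if u \<in> ?S then - ?q u else ?q u) * (u \<bullet> w)"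
    if u: "u \<in> T" for u
  proof -
    have Au: "A *v u = ?q u *\<^sub>R u" using T(2) u by (simp add: orthonormal_eigenvectors_def)
    have uv: "u \<bullet> v i = (if u = v i then 1 else 0)" if "i \<in> {1..k}" for i
    proof -
      have "v i \<in> T" using T(1) that by blast
      then show ?thesis using T(2) u
        by (auto simp: orthonormal_eigenvectors_def pairwise_def orthogonal_def norm_eq_1)
    qed
    have "reflection k v *v u = (if u \<in> ?S then - u else u)"
    proof (cases "u \<in> ?S")
      case True
      then obtain j where j: "u = v j" "j \<in> {1..k}" by (rule imageE)
      have "(\<Sum>i = 1..k. (2 * (v i \<bullet> u)) *\<^sub>R v i) = (\<Sum>i = 1..k. if j = i then 2 *\<^sub>R u else 0)"
        using low j(2) unfolding j(1) by (intro sum.cong) (auto simp: lowest_eigenvectors_def)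
      then show ?thesis using j True by (simp add: reflection_mult_vec scaleR_2)
    next
      case False
      then have "(\<Sum>i = 1..k. (2 * (v i \<bullet> u)) *\<^sub>R v i) = 0"
        using uv by (intro sum.neutral) (auto simp: inner_commute)
      then show ?thesis using False by (simp add: reflection_mult_vec)
    qed
    then have "A *v (reflection k v *v u) = (if u \<in> ?S then - (A *v u) else A *v u)"
      by (simp add: linear_neg[OF matrix_vector_mul_linear])
    also have "\<dots> = (if u \<in> ?S then - ?q u else ?q u) *\<^sub>R u"
      by (subst (1 2) Au) simp
    finally have "(A *v (reflection k v *v u)) \<bullet> w = (if u \<in> ?S then - ?q u else ?q u) * (u \<bullet> w)"
      by simp
    then show ?thesis
      by (simp only: symmetric_inner_matrix[OF transpose_reflection] symmetric_inner_matrix[OF sym])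
  qed
  have "\<mu> * (norm w)\<^sup>2 = (\<Sum>u\<in>T. (u \<bullet> w) * (\<mu> * (u \<bullet> w)))"
    unfolding power2_norm_eq_inner eigenvector_basis_inner[OF T(2,3), of w w] sum_distrib_left
    by (simp only: mult.left_commute)
  also have "\<dots> \<le> (\<Sum>u\<in>T. (u \<bullet> w) * (u \<bullet> (reflection k v *v (A *v w))))"
  proof (rule sum_mono)
    fix u assume u: "u \<in> T"
    have "\<mu> \<le> (if u \<in> ?S then - ?q u else ?q u)"
    proof (cases "u \<in> ?S")
      case True
      then obtain j where j: "u = v j" "j \<in> {1..k}" by (rule imageE)
      then have "?q u = eigval A j" using low by (simp add: lowest_eigenvectors_def)
      then show ?thesis using True neg[OF j(2)] by simp
    next
      case False
      then show ?thesis using rest[of u] u pos by auto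
    qed
    then have "\<mu> * (u \<bullet> w)\<^sup>2 \<le> (if u \<in> ?S then - ?q u else ?q u) * (u \<bullet> w)\<^sup>2"
      by (rule mult_right_mono) simp
    then show "(u \<bullet> w) * (\<mu> * (u \<bullet> w)) \<le> (u \<bullet> w) * (u \<bullet> (reflection k v *v (A *v w)))"
      by (simp add: Rv[OF u] power2_eq_square mult_ac)
  qed
  also have "\<dots> = w \<bullet> (reflection k v *v (A *v w))"
    by (rule eigenvector_basis_inner[OF T(2,3), symmetric])
  finally show ?thesis .
qed

subsection \<open>Symmetry of the Hessian\<close>

lemma C_k_imp_continuous: "C_k m f \<Longrightarrow> continuous_on UNIV f"
  by (cases m) (simp_all add: differentiable_imp_continuous_within continuous_at_imp_continuous_on)

lemma has_derivative_partial_deriv: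
  fixes f :: "real ^ 'n::finite \<Rightarrow> real"
  assumes "f differentiable at x"
  shows "(f has_derivative (\<lambda>h. \<Sum>i\<in>UNIV. partial_deriv i f x * h $ i)) (at x)"
proof -
  let ?D = "frechet_derivative f (at x)"
  have D: "(f has_derivative ?D) (at x)" using assms by (simp add: frechet_derivative_works)
  then interpret bounded_linear ?D by (rule has_derivative_bounded_linear)
  have "?D h = (\<Sum>i\<in>UNIV. partial_deriv i f x * h $ i)" for h
  proof -
    have "?D h = ?D (\<Sum>i\<in>UNIV. h $ i *\<^sub>R axis i 1)"
      by (metis (mono_tags, lifting) basis_expansion scalar_mult_eq_scaleR sum.cong)
    then show ?thesis by (simp add: sum scaleR partial_deriv_def mult.commute)
  qed
  then show ?thesis using D by (metis (no_types, lifting) ext)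
qed

lemma partial_deriv_along_axis:
  fixes f :: "real ^ 'n::finite \<Rightarrow> real"
  assumes "\<And>y. f differentiable at y"
  shows "((\<lambda>t. f (c + t *\<^sub>R axis i 1)) has_field_derivative partial_deriv i f (c + t *\<^sub>R axis i 1)) (at t)"
proof -
  let ?D = "frechet_derivative f (at (c + t *\<^sub>R axis i 1))"
  have D: "(f has_derivative ?D) (at (c + t *\<^sub>R axis i 1))"
    using assms by (simp add: frechet_derivative_works)
  have "((\<lambda>t. c + t *\<^sub>R axis i (1::real)) has_derivative (\<lambda>h. h *\<^sub>R axis i 1)) (at t)"
    by (auto intro!: derivative_eq_intros)
  then have "((\<lambda>t. f (c + t *\<^sub>R axis i 1)) has_derivative (\<lambda>h. ?D (h *\<^sub>R axis i 1))) (at t)"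
    using D by (rule has_derivative_compose)
  then show ?thesis
    using linear_cmul[OF has_derivative_linear[OF D]]
    by (intro has_derivative_imp_has_field_derivative) (auto simp: partial_deriv_def)
qed

text \<open>Two mean value steps, first along \<open>i\<close> and then along \<open>j\<close>. The
  second difference is symmetric in \<open>i\<close> and \<open>j\<close>, whereas the derivative
  obtained records the order.\<close>

lemma second_difference_mean_value:
  fixes f :: "real ^ 'n::finite \<Rightarrow> real"
  assumes f: "\<And>y. f differentiable at y" and fi: "\<And>y. partial_deriv i f differentiable at y"
    and h: "h > 0"
  obtains s t where "0 < s" "s < h" "0 < t" "t < h"
    "f (x + h *\<^sub>R axis i 1 + h *\<^sub>R axis j 1) - f (x + h *\<^sub>R axis i 1) - f (x + h *\<^sub>R axis j 1) + f x
      = h\<^sup>2 * partial_deriv j (partial_deriv i f) (x + s *\<^sub>R axis i 1 + t *\<^sub>R axis j 1)"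
proof -
  let ?a = "axis i 1 :: real ^ 'n" and ?b = "axis j 1 :: real ^ 'n"
  let ?F = "\<lambda>s. f (x + h *\<^sub>R ?b + s *\<^sub>R ?a) - f (x + s *\<^sub>R ?a)"
  let ?F' = "\<lambda>s. partial_deriv i f (x + h *\<^sub>R ?b + s *\<^sub>R ?a) - partial_deriv i f (x + s *\<^sub>R ?a)"
  have "(?F has_field_derivative ?F' s) (at s)" for s
    by (intro DERIV_diff partial_deriv_along_axis f)
  then obtain s where s: "0 < s" "s < h" "?F h - ?F 0 = (h - 0) * ?F' s"
    using MVT2[OF h, of ?F ?F'] by blast
  let ?G = "\<lambda>t. partial_deriv i f (x + s *\<^sub>R ?a + t *\<^sub>R ?b)"
  let ?G' = "\<lambda>t. partial_deriv j (partial_deriv i f) (x + s *\<^sub>R ?a + t *\<^sub>R ?b)"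
  have "(?G has_field_derivative ?G' t) (at t)" for t
    by (intro partial_deriv_along_axis fi)
  then obtain t where t: "0 < t" "t < h" "?G h - ?G 0 = (h - 0) * ?G' t"
    using MVT2[OF h, of ?G ?G'] by blast
  have "?F' s = ?G h - ?G 0" by (simp add: add_ac)
  then have "?F h - ?F 0 = h\<^sup>2 * ?G' t" using s(3) t(3) by (simp add: power2_eq_square)
  then show thesis using s(1,2) t(1,2) by (intro that[of s t]) (simp_all add: algebra_simps)
qed

text \<open>Evaluating one second difference in both orders equates the two mixed partials at two
  points near \<open>x\<close>; continuity at \<open>x\<close> does the rest.\<close>

lemma mixed_partial_deriv_commute:
  fixes f :: "real ^ 'n::finite \<Rightarrow> real"
  assumes "C_k (Suc (Suc m)) f"
  shows "partial_deriv j (partial_deriv i f) x = partial_deriv i (partial_deriv j f) x"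
proof -
  have f: "f differentiable at y" and fi: "partial_deriv k f differentiable at y"
    and C: "C_k m (partial_deriv l (partial_deriv k f))" for y k l
    using assms by simp_all
  note cont = C_k_imp_continuous[OF C]
  let ?P = "partial_deriv j (partial_deriv i f)" and ?Q = "partial_deriv i (partial_deriv j f)"
  have "\<bar>?P x - ?Q x\<bar> \<le> e" if e: "e > 0" for e
  proof -
    obtain d1 where d1: "d1 > 0" "\<And>y. dist y x < d1 \<Longrightarrow> dist (?P y) (?P x) < e / 2"
      using cont[of j i] e unfolding continuous_on_iff by (metis UNIV_I half_gt_zero)
    obtain d2 where d2: "d2 > 0" "\<And>y. dist y x < d2 \<Longrightarrow> dist (?Q y) (?Q x) < e / 2"
      using cont[of i j] e unfolding continuous_on_iff by (metis UNIV_I half_gt_zero)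
    \<comment> \<open>The intermediate points lie at distance less than \<open>2 * h\<close> from
      \<open>x\<close>, hence within both continuity radii.\<close>
    define h where "h = min d1 d2 / 2"
    have h: "h > 0" using d1 d2 by (simp add: h_def)
    obtain s t where st: "0 < s" "s < h" "0 < t" "t < h"
      "f (x + h *\<^sub>R axis i 1 + h *\<^sub>R axis j 1) - f (x + h *\<^sub>R axis i 1) - f (x + h *\<^sub>R axis j 1) + f x
        = h\<^sup>2 * ?P (x + s *\<^sub>R axis i 1 + t *\<^sub>R axis j 1)"
      using second_difference_mean_value[OF f fi h] by blast
    obtain s' t' where st': "0 < s'" "s' < h" "0 < t'" "t' < h"
      "f (x + h *\<^sub>R axis j 1 + h *\<^sub>R axis i 1) - f (x + h *\<^sub>R axis j 1) - f (x + h *\<^sub>R axis i 1) + f x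
        = h\<^sup>2 * ?Q (x + s' *\<^sub>R axis j 1 + t' *\<^sub>R axis i 1)"
      using second_difference_mean_value[OF f fi h] by blast
    have "h\<^sup>2 * ?P (x + s *\<^sub>R axis i 1 + t *\<^sub>R axis j 1) = h\<^sup>2 * ?Q (x + s' *\<^sub>R axis j 1 + t' *\<^sub>R axis i 1)"
      unfolding st(5)[symmetric] st'(5)[symmetric] by (simp add: add_ac)
    then have PQ: "?P (x + s *\<^sub>R axis i 1 + t *\<^sub>R axis j 1) = ?Q (x + s' *\<^sub>R axis j 1 + t' *\<^sub>R axis i 1)"
      using h by simp
    have near: "dist (x + p *\<^sub>R axis k 1 + q *\<^sub>R axis l 1) x < 2 * h"
      if "0 < p" "p < h" "0 < q" "q < h" for p q :: real and k l
    proof -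
      have "dist (x + p *\<^sub>R axis k 1 + q *\<^sub>R axis l 1) x = norm (p *\<^sub>R axis k 1 + q *\<^sub>R axis l 1 :: real ^ 'n)"
        by (simp add: dist_norm)
      also have "\<dots> \<le> p + q"
        using that by (intro order_trans[OF norm_triangle_ineq]) simp
      finally show ?thesis using that by simp
    qed
    have "dist (?P (x + s *\<^sub>R axis i 1 + t *\<^sub>R axis j 1)) (?P x) < e / 2"
      using near[OF st(1-4), of i j] by (intro d1) (simp add: h_def)
    moreover have "dist (?Q (x + s' *\<^sub>R axis j 1 + t' *\<^sub>R axis i 1)) (?Q x) < e / 2"
      using near[OF st'(1-4), of j i] by (intro d2) (simp add: h_def)
    ultimately show ?thesis unfolding dist_real_def PQ by linarith
  qed
  then have "\<bar>?P x - ?Q x\<bar> \<le> 0" by (rule field_le_epsilon[of _ 0, simplified])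
  then show ?thesis by simp
qed

lemma hessian_symmetric:
  "C_k (Suc (Suc m)) f \<Longrightarrow> transpose (hessian f x) = hessian f x"
  by (simp add: vec_eq_iff transpose_def hessian_def mixed_partial_deriv_commute del: C_k.simps)

lemma grad_has_derivative_hessian:
  fixes f :: "real ^ 'n::finite \<Rightarrow> real"
  assumes "C_k (Suc (Suc m)) f"
  shows "(grad f has_derivative (\<lambda>h. hessian f x *v h)) (at x)"
proof -
  have "partial_deriv i f differentiable at x" for i
    using assms by simp
  then have "(partial_deriv i f has_derivative (\<lambda>h. (hessian f x *v h) $ i)) (at x)" for i
    using has_derivative_partial_deriv[of "partial_deriv i f" x]
    by (simp add: matrix_vector_mult_def hessian_def)
  then show ?thesis
    unfolding has_derivative_componentwise_within[of "grad f"]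
    by (auto simp: Basis_vec_def grad_def inner_axis)
qed

subsection \<open>The cubic step\<close>

lemma norm_cube_add_le:
  fixes s h :: "'a::real_inner"
  shows "norm (s + h) ^ 3 \<le> norm s ^ 3 + 3 * norm s * (s \<bullet> h) + (norm h)\<^sup>2 * (3 * norm s + norm h)"
proof -
  let ?a = "norm s" and ?b = "norm (s + h)" and ?c = "norm h"
  \<comment> \<open>With \<open>a = \<parallel>s\<parallel>\<close> and \<open>b = \<parallel>s + h\<parallel>\<close>:
    \<open>b\<^sup>3 = a\<^sup>3 + 3/2 a (b\<^sup>2 - a\<^sup>2) + (b - a)\<^sup>2 (b + a/2)\<close>. This avoids differentiating the norm at 0.\<close>
  have ab: "?b\<^sup>2 = ?a\<^sup>2 + 2 * (s \<bullet> h) + ?c\<^sup>2"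
    by (simp add: power2_norm_eq_inner inner_add_left inner_add_right inner_commute)
  have b: "?b \<le> ?a + ?c" by (rule norm_triangle_ineq)
  have "\<bar>?b - ?a\<bar> \<le> ?c" by (metis add_diff_cancel_left' norm_triangle_ineq3)
  then have "(?b - ?a)\<^sup>2 \<le> ?c\<^sup>2" by (metis abs_le_square_iff abs_norm_cancel)
  then have "(?b - ?a)\<^sup>2 * (?b + ?a / 2) \<le> ?c\<^sup>2 * (3 / 2 * ?a + ?c)"
    using b by (intro mult_mono) auto
  moreover have "?b ^ 3 = ?a ^ 3 + 3 / 2 * ?a * (?b\<^sup>2 - ?a\<^sup>2) + (?b - ?a)\<^sup>2 * (?b + ?a / 2)"
    by (simp add: power2_eq_square power3_eq_cube algebra_simps)
  ultimately have "?b ^ 3 \<le> ?a ^ 3 + 3 / 2 * ?a * (2 * (s \<bullet> h) + ?c\<^sup>2) + ?c\<^sup>2 * (3 / 2 * ?a + ?c)"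
    unfolding ab by simp
  then show ?thesis by (simp add: algebra_simps)
qed

text \<open>The minimizer is compared with \<open>s - t *\<^sub>R p\<close>, where \<open>p\<close>
  is the gradient of the model at \<open>s\<close>: the first-order change is
  \<open>- t * (p \<bullet> p)\<close>, the rest is at most \<open>t\<^sup>2 * K\<close>.\<close>

lemma cubic_model_minimizer_stationary:
  assumes sym: "transpose B = B" and \<sigma>: "\<sigma> \<ge> 0"
    and min: "\<And>t. cubic_model c g B \<sigma> s \<le> cubic_model c g B \<sigma> t"
  shows "g + B *v s + (\<sigma> * norm s) *\<^sub>R s = 0"
proof -
  define p where "p = g + B *v s + (\<sigma> * norm s) *\<^sub>R s"
  define K where "K = (1 / 2) * (p \<bullet> (B *v p)) + \<sigma> / 3 * ((norm p)\<^sup>2 * (3 * norm s + norm p))"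
  have "p \<bullet> p = 0"
  proof (rule linear_le_quadratic_imp_zero)
    fix t :: real
    assume t: "0 < t" "t \<le> 1"
    define h where "h = - (t *\<^sub>R p)"
    have nh: "norm h = t * norm p" using t by (simp add: h_def)
    have "cubic_model c g B \<sigma> s \<le> cubic_model c g B \<sigma> (s + h)" by (rule min)
    moreover have "h \<bullet> (B *v s) = s \<bullet> (B *v h)"
      by (simp add: symmetric_inner_matrix[OF sym, of s h] inner_commute)
    ultimately have 1: "\<sigma> / 3 * norm s ^ 3 \<le> g \<bullet> h + h \<bullet> (B *v s) + (1 / 2) * (h \<bullet> (B *v h))
        + \<sigma> / 3 * norm (s + h) ^ 3"
      by (simp add: cubic_model_def inner_add_left inner_add_right matrix_vector_right_distrib
          algebra_simps)
    \<comment> \<open>Since \<open>t \<le> 1\<close>, the third-order part is absorbed into the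
      quadratic one.\<close>
    have "(norm h)\<^sup>2 * (3 * norm s + norm h) \<le> t\<^sup>2 * ((norm p)\<^sup>2 * (3 * norm s + norm p))"
      unfolding nh power_mult_distrib mult.assoc using t
      by (intro mult_left_mono add_left_mono) (simp_all add: mult_left_le_one_le)
    then have "norm (s + h) ^ 3 \<le> norm s ^ 3 + 3 * norm s * (s \<bullet> h)
        + t\<^sup>2 * ((norm p)\<^sup>2 * (3 * norm s + norm p))"
      using norm_cube_add_le[of s h] by linarith
    then have "\<sigma> / 3 * norm (s + h) ^ 3 \<le> \<sigma> / 3 * (norm s ^ 3 + 3 * norm s * (s \<bullet> h)
        + t\<^sup>2 * ((norm p)\<^sup>2 * (3 * norm s + norm p)))"
      using \<sigma> by (intro mult_left_mono) auto
    with 1 have "0 \<le> g \<bullet> h + h \<bullet> (B *v s) + \<sigma> * norm s * (s \<bullet> h) + (1 / 2) * (h \<bullet> (B *v h))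
        + t\<^sup>2 * (\<sigma> / 3 * ((norm p)\<^sup>2 * (3 * norm s + norm p)))"
      by (simp add: algebra_simps)
    moreover have "g \<bullet> h + h \<bullet> (B *v s) + \<sigma> * norm s * (s \<bullet> h) = p \<bullet> h"
      by (simp add: p_def inner_add_left inner_commute[of h])
    moreover have "p \<bullet> h = - (t * (p \<bullet> p))" by (simp add: h_def)
    moreover have "h \<bullet> (B *v h) = t\<^sup>2 * (p \<bullet> (B *v p))"
      by (simp add: h_def linear_neg[OF matrix_vector_mul_linear] matrix_vector_mult_scaleR
          power2_eq_square)
    ultimately show "t * (p \<bullet> p) \<le> t\<^sup>2 * K"
      by (simp add: K_def algebra_simps)
  qed simp
  then show ?thesis by (simp add: p_def)
qed

text \<open>One step as pure linear algebra: calculus enters only through the two bounds relating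
  \<open>g\<close> to the error \<open>e\<close>.\<close>

lemma cubic_step_error:
  fixes H :: "real ^ 'n::finite ^ 'n" and e g s :: "real ^ 'n"
  assumes sym: "transpose H = H" and low: "lowest_eigenvectors k H v"
    and neg: "\<And>i. i \<in> {1..k} \<Longrightarrow> eigval H i \<le> - \<mu>"
    and pos: "\<And>i. i \<in> {k+1..CARD('n)} \<Longrightarrow> \<mu> \<le> eigval H i"
    and \<mu>: "\<mu> > 0" and \<sigma>: "\<sigma> \<ge> 0"
    and min: "\<And>t. cubic_model c (reflection k v *v g) (sym_part (reflection k v ** H)) \<sigma> s
      \<le> cubic_model c (reflection k v *v g) (sym_part (reflection k v ** H)) \<sigma> t"
    and g: "norm g \<le> L * norm e" and lin: "norm (g - H *v e) \<le> M * (norm e)\<^sup>2"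
  shows "\<mu> * norm (e + s) \<le> (M + \<sigma> * (L / \<mu>)\<^sup>2) * (norm e)\<^sup>2"
proof -
  let ?R = "reflection k v"
  note refl = reflection_symmetric[OF sym low]
  have stat: "?R *v g + ?R *v (H *v s) + (\<sigma> * norm s) *\<^sub>R s = 0"
    using cubic_model_minimizer_stationary[OF _ \<sigma> min] refl
    by (simp flip: matrix_vector_mul_assoc)
  \<comment> \<open>The reflection preserves norms, so by Cauchy-Schwarz positive definiteness of
    the reflected matrix bounds the indefinite \<open>H\<close> from below.\<close>
  have coercive: "\<mu> * norm w \<le> norm (H *v w)" for w
  proof (cases "w = 0")
    case False
    have "\<mu> * (norm w)\<^sup>2 \<le> norm w * norm (?R *v (H *v w))"
      using reflection_positive_definite[OF sym low neg pos, of w] norm_cauchy_schwarz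
      by (rule order_trans) auto
    then show ?thesis using False by (simp add: norm_reflection[OF low] power2_eq_square)
  qed simp
  have s: "norm s \<le> L / \<mu> * norm e"
  proof (cases "s = 0")
    case True
    have "0 \<le> L * norm e" using g norm_ge_zero order_trans by blast
    then show ?thesis using True \<mu> by simp
  next
    case False
    have "s \<bullet> (?R *v (H *v s)) = - (s \<bullet> (?R *v g)) - \<sigma> * norm s * (norm s)\<^sup>2"
      using arg_cong[OF stat, of "\<lambda>z. s \<bullet> z"]
      by (simp add: inner_add_right power2_norm_eq_inner)
    also have "\<dots> \<le> - (s \<bullet> (?R *v g))" using \<sigma> by simp
    also have "\<dots> \<le> norm s * norm (?R *v g)"
      using Cauchy_Schwarz_ineq2[of s "?R *v g"] by linarith
    finally have "\<mu> * (norm s)\<^sup>2 \<le> norm s * norm g"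
      using reflection_positive_definite[OF sym low neg pos, of s]
      by (simp add: norm_reflection[OF low])
    then have "\<mu> * norm s \<le> norm g" using False by (simp add: power2_eq_square)
    then show ?thesis using g \<mu> by (simp add: field_simps)
  qed
  have "g + H *v s + (\<sigma> * norm s) *\<^sub>R (?R *v s) = 0"
    using arg_cong[OF stat, of "\<lambda>z. ?R *v z"]
    by (simp add: matrix_vector_right_distrib matrix_vector_mult_scaleR reflection_involution[OF low])
  then have "H *v (e + s) = - (g - H *v e) - (\<sigma> * norm s) *\<^sub>R (?R *v s)"
    by (simp add: matrix_vector_right_distrib algebra_simps eq_neg_iff_add_eq_0)
  then have "norm (H *v (e + s)) \<le> norm (g - H *v e) + \<sigma> * (norm s)\<^sup>2"
    using norm_triangle_ineq4[of "- (g - H *v e)" "(\<sigma> * norm s) *\<^sub>R (?R *v s)"] \<sigma>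
    by (simp add: norm_reflection[OF low] power2_eq_square norm_minus_commute)
  also have "\<dots> \<le> M * (norm e)\<^sup>2 + \<sigma> * (L / \<mu> * norm e)\<^sup>2"
    using lin s \<sigma> by (intro add_mono mult_left_mono power_mono) auto
  also have "\<dots> = (M + \<sigma> * (L / \<mu>)\<^sup>2) * (norm e)\<^sup>2"
    by (simp only: power_mult_distrib distrib_right mult.assoc)
  finally show ?thesis using coercive[of "e + s"] by linarith
qed

section \<open>Invariant ball and quadratic convergence\<close>

theorem proposition2p3:
  fixes f :: "real ^ 'n::finite \<Rightarrow> real"
    and xs :: "real ^ 'n"
    and x :: "nat \<Rightarrow> real ^ 'n"
    and \<sigma> :: "nat \<Rightarrow> real"
    and k :: nat
    and r\<^sub>0 M L \<mu> \<sigma>_min \<sigma>_max C r :: real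
    and U :: "(real ^ 'n) set"
  assumes dim: "CARD('n) \<ge> 2"
    and f_C3: "C_k 3 f"
    and finite_crit: "finite {y. nondegenerate_critical_point f y}"
    and k_le: "k \<le> CARD('n)"
    and crit: "strict_index_critical_point k f xs"
    and pos: "r\<^sub>0 > 0" "M > 0" "L \<ge> \<mu>" "\<mu> > 0"
    and U_def: "U = {y. norm (y - xs) \<le> r\<^sub>0}"
    and lipschitz: "\<forall>y\<in>U. \<forall>z\<in>U. spectral_norm (hessian f y - hessian f z) \<le> M * norm (y - z)"
    and eig_neg: "\<forall>y\<in>U. \<forall>i\<in>{1..k}. -L \<le> eigval (hessian f y) i \<and> eigval (hessian f y) i \<le> -\<mu>"
    and eig_pos: "\<forall>y\<in>U. \<forall>i\<in>{k+1..CARD('n)}. \<mu> \<le> eigval (hessian f y) i \<and> eigval (hessian f y) i \<le> L"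
    and sigma: "0 < \<sigma>_min" "\<forall>j. \<sigma>_min \<le> \<sigma> j \<and> \<sigma> j \<le> \<sigma>_max"
    and iter: "cubic_reg_sequence k f \<sigma> x"
    and C_def: "C = 2 * L\<^sup>2 * (\<sigma>_max + M / 2) / \<mu> ^ 3"
    and r: "r > 0" "r \<le> Min {\<mu> * r\<^sub>0 / (\<mu> + L), \<mu>\<^sup>2 / (M * (\<mu> + L)), 1 / C}"
    and start: "norm (x 0 - xs) \<le> r"
  shows "(\<forall>j. x j \<in> U) \<and> (\<forall>j. norm (x (Suc j) - xs) \<le> C * (norm (x j - xs))\<^sup>2)"
proof -
  \<comment> \<open>In successor form, order 3 matches \<open>Suc (Suc m)\<close> with
    \<open>m = Suc 0\<close>.\<close>
  note C2 = f_C3[unfolded numeral_3_eq_3]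
  have sym: "transpose (hessian f y) = hessian f y" for y by (rule hessian_symmetric[OF C2])
  have deriv: "(grad f has_derivative (\<lambda>h. hessian f y *v h)) (at y within S)" for y S
    by (rule has_derivative_at_withinI[OF grad_has_derivative_hessian[OF C2]])
  have U: "U = cball xs r\<^sub>0" by (auto simp: U_def dist_norm norm_minus_commute)
  have eig: "\<bar>eigval (hessian f y) i\<bar> \<le> L" if "y \<in> U" "i \<in> {1..CARD('n)}" for y i
  proof (cases "i \<le> k")
    case True
    then have "-L \<le> eigval (hessian f y) i \<and> eigval (hessian f y) i \<le> -\<mu>"
      using eig_neg that by auto
    then show ?thesis using pos by linarith
  next
    case False
    then have "\<mu> \<le> eigval (hessian f y) i \<and> eigval (hessian f y) i \<le> L"
      using eig_pos that by auto
    then show ?thesis using pos by linarith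
  qed
  have r_bounds: "r \<le> \<mu> * r\<^sub>0 / (\<mu> + L)" "r \<le> 1 / C" using r(2) by simp_all
  have "\<mu> * r\<^sub>0 / (\<mu> + L) \<le> r\<^sub>0" using pos by (simp add: field_simps)
  with r_bounds have r_r0: "r \<le> r\<^sub>0" by linarith
  have "\<sigma>_max > 0" using sigma by (meson less_le_trans)
  then have C: "C > 0" using pos by (simp add: C_def)
  then have Cr: "C * r \<le> 1" using r_bounds by (simp add: field_simps)
  have step: "norm (x (Suc j) - xs) \<le> C * (norm (x j - xs))\<^sup>2" if xj: "norm (x j - xs) \<le> r" for j
  proof -
    let ?H = "hessian f (x j)" and ?e = "x j - xs"
    have xs_U: "xs \<in> U" and xj_U: "x j \<in> U" using xj r_r0 pos by (auto simp: U_def)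
    obtain v s where low: "lowest_eigenvectors k ?H v" and x': "x (Suc j) = x j + s"
      and min: "\<And>t. cubic_model (f (x j)) (reflection k v *v grad f (x j))
          (sym_part (reflection k v ** ?H)) (\<sigma> j) s
        \<le> cubic_model (f (x j)) (reflection k v *v grad f (x j))
          (sym_part (reflection k v ** ?H)) (\<sigma> j) t"
      using iter unfolding cubic_reg_sequence_def cubic_reg_step_def by blast
    have crit0: "grad f xs = 0"
      using crit by (simp add: strict_index_critical_point_def nondegenerate_critical_point_def)
    \<comment> \<open>The eigenvalue bounds make the gradient \<open>L\<close>-Lipschitz on the
      convex ball \<open>U\<close>, and it vanishes at \<open>xs\<close>.\<close>
    have "onorm (\<lambda>h. hessian f y *v h) \<le> L" if "y \<in> U" for y
      using symmetric_norm_le[OF sym eig[OF that]] by (rule onorm_le)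
    then have "norm (grad f (x j) - grad f xs) \<le> L * norm ?e"
      using xs_U xj_U deriv unfolding U by (intro differentiable_bound[of "cball xs r\<^sub>0"]) auto
    then have g: "norm (grad f (x j)) \<le> L * norm ?e" by (simp add: crit0)
    have seg: "closed_segment xs (x j) \<subseteq> U"
      using xs_U xj_U unfolding U by (simp add: closed_segment_subset)
    \<comment> \<open>The gradient is linearized at \<open>x j\<close>, whose Hessian the step uses.
      On the segment to \<open>xs\<close> the Hessian deviates from it by at most
      \<open>M * norm ?e\<close>.\<close>
    have "norm (grad f (x j) - grad f xs - ?H *v ?e) \<le> norm ?e * (M * norm ?e)"
    proof (rule differentiable_bound_linearization[where S = "closed_segment xs (x j)"
          and f' = "\<lambda>y. (*v) (hessian f y)" and ?x0.0 = "x j"])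
      show "xs + t *\<^sub>R ?e \<in> closed_segment xs (x j)" if "t \<in> {0..1}" for t
        using that by (auto simp: closed_segment_def algebra_simps)
      show "(grad f has_derivative (*v) (hessian f y)) (at y within closed_segment xs (x j))" for y
        by (rule deriv)
      show "onorm ((*v) (hessian f y) - (*v) ?H) \<le> M * norm ?e"
        if y: "y \<in> closed_segment xs (x j)" for y
      proof -
        have "onorm ((*v) (hessian f y) - (*v) ?H) = spectral_norm (hessian f y - ?H)"
          by (simp add: spectral_norm_def matrix_vector_mult_diff_rdistrib fun_diff_def)
        also have "\<dots> \<le> M * norm (y - x j)" using lipschitz y seg xj_U by blast
        also have "\<dots> \<le> M * norm ?e"
          using segment_bound(2)[OF y] pos by (simp add: norm_minus_commute)
        finally show ?thesis .
      qed
    qed simp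
    then have lin: "norm (grad f (x j) - ?H *v ?e) \<le> M * (norm ?e)\<^sup>2"
      by (simp add: crit0 power2_eq_square mult_ac)
    have "\<sigma> j \<ge> 0" using sigma by (meson less_imp_le order_trans)
    then have "\<mu> * norm (?e + s) \<le> (M + \<sigma> j * (L / \<mu>)\<^sup>2) * (norm ?e)\<^sup>2"
      using eig_neg eig_pos xj_U pos(4)
      by (intro cubic_step_error[OF sym low _ _ _ _ min g lin]) auto
    also have "\<dots> \<le> (\<mu> * C) * (norm ?e)\<^sup>2"
    proof (rule mult_right_mono)
      \<comment> \<open>The factor 2 in \<open>C\<close> turns \<open>M / 2\<close> into the
        \<open>M\<close> of the mean value bound, and \<open>\<mu> \<le> L\<close> lets
        \<open>(L / \<mu>)\<^sup>2\<close> multiply it.\<close>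
      have "1 \<le> (L / \<mu>)\<^sup>2" using pos by (intro one_le_power) simp
      then have "M * 1 \<le> M * (L / \<mu>)\<^sup>2" using pos by (intro mult_left_mono) auto
      moreover have "\<sigma> j * (L / \<mu>)\<^sup>2 \<le> \<sigma>_max * (L / \<mu>)\<^sup>2"
        using sigma by (intro mult_right_mono) auto
      moreover have "0 \<le> \<sigma>_max * (L / \<mu>)\<^sup>2" using \<open>\<sigma>_max > 0\<close> by simp
      moreover have "\<mu> * C = 2 * (\<sigma>_max * (L / \<mu>)\<^sup>2) + M * (L / \<mu>)\<^sup>2"
        using pos by (simp add: C_def field_simps power2_eq_square power3_eq_cube)
      ultimately show "M + \<sigma> j * (L / \<mu>)\<^sup>2 \<le> \<mu> * C" by linarith
    qed simp
    finally have "norm (?e + s) \<le> C * (norm ?e)\<^sup>2" using pos by (simp add: mult.assoc)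
    then show ?thesis by (simp add: x' algebra_simps)
  qed
  \<comment> \<open>\<open>C * r \<le> 1\<close> makes the ball of radius \<open>r\<close>
    invariant, so the one-step estimate applies at every \<open>j\<close>.\<close>
  have near: "norm (x j - xs) \<le> r" for j
  proof (induction j)
    case 0
    then show ?case by (rule start)
  next
    case (Suc j)
    have "norm (x (Suc j) - xs) \<le> C * (norm (x j - xs))\<^sup>2" by (rule step[OF Suc])
    also have "\<dots> \<le> C * r\<^sup>2" using Suc C by (intro mult_left_mono power_mono) auto
    also have "\<dots> = (C * r) * r" by (simp add: power2_eq_square)
    also have "\<dots> \<le> r" using Cr r(1) by (simp add: mult_left_le_one_le C less_imp_le)
    finally show ?case .
  qed
  then show ?thesis using step r_r0 by (auto simp: U_def intro: order_trans)
qed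

end
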